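(* Let $G$ be a finite graph and $k\geq 2$ an integer such that $G^{k-1}$ is an interval graph. Let $R=(I_x)_{x\in V(G)}$ be any interval representation of $G^{k-1}$. Then $R$ can be extended to an interval representation $R'=(I'_x)_{x\in V(G)}$ of $G^k$ (that is, $I_x\subseteq I'_x$ for every vertex $x$) such that $R$ and $R'$ induce the same left endpoint order and the same right endpoint order.
   Context: For a graph $G$ and integer $k\geq 1$, the $k$th power $G^k$ is the graph on $V(G)$ in which two distinct vertices are adjacent iff their distance in $G$ is at most $k$. An interval representation of a graph $H$ is a family $(I_x)_{x\in V(H)}$ of closed real intervals such that two distinct vertices $x,y$ are adjacent in $H$ iff $I_x\cap I_y\neq\emptyset$; $H$ is an interval graph if it has one. Writing $\ell(I)$ and $r(I)$ for the left and right endpoints of an interval $I$, the left endpoint order induced by a representation is the (pre)order $\leqslant_L$ on the vertices given by $x\leqslant_L y$ iff $\ell(I_x)\leq \ell(I_y)$, and the right endpoint order $\leqslant_R$ is given by $x\leqslant_R y$ iff $r(I_x)\leq r(I_y)$ (ties allowed). Two representations induce the same order if these relations coincide on all pairs of vertices. *)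

theory Defs
  imports
    "Graph_Theory.Pair_Digraph"
    "Graph_Theory.Shortest_Path"
    "HOL-Library.Interval"
begin

text \<open>
  A finite simple graph is a \<^locale>\<open>pair_graph\<close>: every edge is represented by
  its two opposite arcs, and there are no loops or parallel arcs.
\<close>

text \<open>The least number of arcs on a walk, which is infinite if there is none.\<close>

definition graph_dist :: "'a pair_pre_digraph \<Rightarrow> 'a \<Rightarrow> 'a \<Rightarrow> ereal" where
  "graph_dist G u v = wf_digraph.\<mu> (with_proj G) (\<lambda>_. 1) u v"

definition graph_power :: "'a pair_pre_digraph \<Rightarrow> nat \<Rightarrow> 'a pair_pre_digraph" where
  "graph_power G k =
     \<lparr> pverts = pverts G,
       parcs = {(u, v). u \<in> pverts G \<and> v \<in> pverts G \<and> u \<noteq> v \<and>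
                        graph_dist G u v \<le> ereal (real k)} \<rparr>"

text \<open>
  The type \<^typ>\<open>real interval\<close> consists of the nonempty closed bounded intervals.
  The values of \<open>I\<close> outside the vertex set are irrelevant.
\<close>

definition interval_representation :: "'a pair_pre_digraph \<Rightarrow> ('a \<Rightarrow> real interval) \<Rightarrow> bool" where
  "interval_representation H I \<longleftrightarrow>
     (\<forall>x \<in> pverts H. \<forall>y \<in> pverts H. x \<noteq> y \<longrightarrow>
        ((x, y) \<in> parcs H \<longleftrightarrow> set_of (I x) \<inter> set_of (I y) \<noteq> {}))"

definition interval_graph :: "'a pair_pre_digraph \<Rightarrow> bool" where
  "interval_graph H \<longleftrightarrow> pair_graph H \<and> (\<exists>I. interval_representation H I)"

definition left_endpoint_order :: "'a set \<Rightarrow> ('a \<Rightarrow> real interval) \<Rightarrow> 'a rel" where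
  "left_endpoint_order V I = {(x, y). x \<in> V \<and> y \<in> V \<and> lower (I x) \<le> lower (I y)}"

definition right_endpoint_order :: "'a set \<Rightarrow> ('a \<Rightarrow> real interval) \<Rightarrow> 'a rel" where
  "right_endpoint_order V I = {(x, y). x \<in> V \<and> y \<in> V \<and> upper (I x) \<le> upper (I y)}"

lemma (in wf_digraph) awalk_cost_unit: "awalk_cost (\<lambda>_. 1) p = real (length p)"
  by (induction p) simp_all

lemma (in pair_wf_digraph) graph_dist_le_iff:
  "graph_dist G u v \<le> ereal (real k) \<longleftrightarrow> (\<exists>p. awalk u p v \<and> length p \<le> k)"
proof
  assume le: "graph_dist G u v \<le> ereal (real k)"
  have "graph_dist G u v < ereal (real (Suc k))"
    by (rule le_less_trans[OF le]) simp
  then obtain p where "awalk u p v" "ereal (awalk_cost (\<lambda>_. 1) p) < ereal (real (Suc k))"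
    unfolding graph_dist_def \<mu>_def by (auto simp: INF_less_iff)
  then show "\<exists>p. awalk u p v \<and> length p \<le> k"
    by (auto simp: awalk_cost_unit)
next
  assume "\<exists>p. awalk u p v \<and> length p \<le> k"
  then obtain p where p: "awalk u p v" "length p \<le> k" by blast
  have "graph_dist G u v \<le> ereal (awalk_cost (\<lambda>_. 1) p)"
    unfolding graph_dist_def by (rule min_cost_le_walk_cost[OF p(1)])
  also have "\<dots> \<le> ereal (real k)" using p(2) by (simp add: awalk_cost_unit)
  finally show "graph_dist G u v \<le> ereal (real k)" .
qed

lemma length_rev_path: "length (rev_path p) = length p"
  by (induction p) simp_all

lemma (in pair_graph) pair_graph_graph_power: "pair_graph (graph_power G k)"
proof -
  have sym: "graph_dist G v u \<le> ereal (real k)" if "graph_dist G u v \<le> ereal (real k)" for u v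
  proof -
    obtain p where "awalk u p v" "length p \<le> k"
      using \<open>graph_dist G u v \<le> ereal (real k)\<close> by (auto simp: graph_dist_le_iff)
    then have "awalk v (rev_path p) u" "length (rev_path p) \<le> k"
      by (simp_all add: length_rev_path)
    then show ?thesis unfolding graph_dist_le_iff by blast
  qed
  have "finite (parcs (graph_power G k))"
    by (rule finite_subset[of _ "pverts G \<times> pverts G"])
       (auto simp: graph_power_def pair_finite_verts)
  then show ?thesis
    by unfold_locales
       (auto simp: graph_power_def pair_finite_verts symmetric_def sym
             intro!: symI)
qed

end

theory Submission
  imports Defs
begin

text \<open>
  Let \<open>m = k - 1\<close>, and suppose that \<open>I\<^sub>x\<close> lies entirely to the left of \<open>I\<^sub>y\<close> while \<open>x\<close> and
  \<open>y\<close> are at distance \<open>m + 1\<close>. Every inner vertex of a shortest path is at distance at most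
  \<open>m\<close> from both ends, so its interval covers the gap between \<open>I\<^sub>x\<close> and \<open>I\<^sub>y\<close>. Hence
  distance at most \<open>m + 1\<close> persists when \<open>r(I\<^sub>x)\<close> or \<open>l(I\<^sub>y)\<close> is moved within the gap to an
  endpoint of another vertex: use the neighbour of the other end on the path. It therefore
  suffices to prolong each \<open>I\<^sub>x\<close> to the right up to the last \<open>l(I\<^sub>y)\<close> with \<open>y\<close> at distance at
  most \<open>m + 1\<close>, and to break the resulting ties by a small increasing perturbation.
\<close>

context pair_graph
begin

lemma graph_dist_sym_le:
  assumes "graph_dist G u v \<le> ereal (real n)"
  shows "graph_dist G v u \<le> ereal (real n)"
proof -
  obtain p where "awalk u p v" "length p \<le> n"
    using assms by (auto simp: graph_dist_le_iff)
  then have "awalk v (rev_path p) u" "length (rev_path p) \<le> n"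
    by (simp_all add: length_rev_path)
  then show ?thesis unfolding graph_dist_le_iff by blast
qed

lemma graph_dist_self_le: "u \<in> pverts G \<Longrightarrow> graph_dist G u u \<le> ereal (real n)"
  unfolding graph_dist_le_iff by (intro exI[of _ "[]"]) (simp add: awalk_Nil_iff)

text \<open>Cut a walk after its first \<open>a\<close> arcs; a shorter walk just leaves the second
  piece empty. This supplies the inner vertices of paths used later.\<close>

lemma graph_dist_le_add_iff:
  "graph_dist G u v \<le> ereal (real (a + b)) \<longleftrightarrow>
     (\<exists>w\<in>pverts G. graph_dist G u w \<le> ereal (real a) \<and> graph_dist G w v \<le> ereal (real b))"
  (is "?L \<longleftrightarrow> ?R")
proof
  assume ?L
  then obtain p where p: "awalk u p v" "length p \<le> a + b"
    by (auto simp only: graph_dist_le_iff)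
  from p(1) have "awalk u (take a p @ drop a p) v" by simp
  then obtain w where w: "awalk u (take a p) w" "awalk w (drop a p) v"
    unfolding awalk_append_iff by blast
  have "w \<in> pverts G" using w(2) by (auto simp: awalk_def)
  moreover have "length (take a p) \<le> a" "length (drop a p) \<le> b" using p(2) by auto
  ultimately show ?R using w unfolding graph_dist_le_iff by blast
next
  assume ?R
  then obtain w p q where "awalk u p w" "length p \<le> a" "awalk w q v" "length q \<le> b"
    by (auto simp only: graph_dist_le_iff)
  then have "awalk u (p @ q) v" "length (p @ q) \<le> a + b"
    by (auto simp: awalk_append_iff)
  then show ?L unfolding graph_dist_le_iff by blast
qed

end

lemma intervals_meet_iff:
  fixes A B :: "real interval"
  shows "set_of A \<inter> set_of B \<noteq> {} \<longleftrightarrow> lower A \<le> upper B \<and> lower B \<le> upper A"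
proof -
  have "max (lower A) (lower B) \<in> set_of A \<inter> set_of B"
    if "lower A \<le> upper B" "lower B \<le> upper A"
    using that by (auto simp: set_of_eq max_def)
  then show ?thesis by (fastforce simp: set_of_eq)
qed

text \<open>The part of the argument that needs no graph: \<open>D\<close> stands for distance at
  most \<open>k\<close>, \<open>f\<close> for the new right endpoints. The two shift hypotheses say
  that \<open>D\<close> persists when one endpoint moves within the gap.\<close>

lemma right_prolongation:
  fixes L R :: "'a \<Rightarrow> real"
  assumes fin: "finite V"
    and sym: "\<And>x y. D x y \<Longrightarrow> D y x"
    and meet: "\<And>x y. x \<in> V \<Longrightarrow> y \<in> V \<Longrightarrow> L x \<le> R y \<Longrightarrow> L y \<le> R x \<Longrightarrow> D x y"
    and shift_left: "\<And>x y y'. x \<in> V \<Longrightarrow> y \<in> V \<Longrightarrow> y' \<in> V \<Longrightarrow>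
          D x y \<Longrightarrow> R x < L y' \<Longrightarrow> L y' \<le> L y \<Longrightarrow> D x y'"
    and shift_right: "\<And>x x' y. x \<in> V \<Longrightarrow> x' \<in> V \<Longrightarrow> y \<in> V \<Longrightarrow>
          D x y \<Longrightarrow> R x \<le> R x' \<Longrightarrow> R x' < L y \<Longrightarrow> D x' y"
  obtains f where "\<And>x. x \<in> V \<Longrightarrow> R x \<le> f x"
    and "\<And>x y. x \<in> V \<Longrightarrow> y \<in> V \<Longrightarrow> f x \<le> f y \<longleftrightarrow> R x \<le> R y"
    and "\<And>x y. x \<in> V \<Longrightarrow> y \<in> V \<Longrightarrow> D x y \<longleftrightarrow> L x \<le> f y \<and> L y \<le> f x"
proof -
  \<comment> \<open>Inserting \<open>R x\<close> keeps the set nonempty and prevents shrinking.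
    Distinct values of \<open>R\<close> may still give equal values of \<open>h\<close>.\<close>
  define h where "h x = Max (insert (R x) (L ` {y \<in> V. D x y}))" for x
  define c where "c = Min (R ` V)"
  have h_ge: "R x \<le> h x" for x
    unfolding h_def using fin by (intro Max_ge) auto
  have h_ge_L: "L y \<le> h x" if "y \<in> V" "D x y" for x y
    unfolding h_def using fin that by (intro Max_ge) auto
  have h_cases: "h x = R x \<or> (\<exists>y\<in>V. D x y \<and> h x = L y)" for x
  proof -
    have "h x \<in> insert (R x) (L ` {y \<in> V. D x y})"
      unfolding h_def using fin by (intro Max_in) auto
    then show ?thesis by auto
  qed
  have h_mono: "h x \<le> h x'" if "x \<in> V" "x' \<in> V" "R x \<le> R x'" for x x'
    using h_cases[of x]
  proof (elim disjE bexE conjE)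
    assume "h x = R x"
    then show ?thesis using that(3) h_ge[of x'] by simp
  next
    \<comment> \<open>Either \<open>L y\<close> lies beyond \<open>R x'\<close>, and
      \<open>shift_right\<close> makes \<open>y\<close> a candidate for \<open>h x'\<close> too, or
      already \<open>L y \<le> R x' \<le> h x'\<close>.\<close>
    fix y assume y: "y \<in> V" "D x y" "h x = L y"
    show ?thesis
    proof (cases "R x' < L y")
      case True
      then show ?thesis using shift_right[OF that(1,2) y(1,2) that(3)] h_ge_L y by simp
    next
      case False
      then show ?thesis using y(3) h_ge[of x'] by simp
    qed
  qed
  have c_le: "c \<le> R x" if "x \<in> V" for x
    unfolding c_def using fin that by simp
  \<comment> \<open>The perturbation must not reach a left endpoint strictly beyond
    \<open>h x\<close>. These are finitely many strict conditions, each true for all small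
    \<open>e > 0\<close>.\<close>
  have "\<forall>\<^sub>F e in at_right 0. \<forall>p \<in> {(x, y) \<in> V \<times> V. h x < L y}.
          e * (R (fst p) - c) < L (snd p) - h (fst p)"
  proof (intro eventually_ball_finite ballI)
    show "finite {(x, y) \<in> V \<times> V. h x < L y}"
      by (rule finite_subset[of _ "V \<times> V"]) (use fin in auto)
    fix p assume "p \<in> {(x, y) \<in> V \<times> V. h x < L y}"
    then have "0 < L (snd p) - h (fst p)" by auto
    moreover have "((\<lambda>e. e * (R (fst p) - c)) \<longlongrightarrow> 0 * (R (fst p) - c)) (at_right 0)"
      by (intro tendsto_intros)
    ultimately show "\<forall>\<^sub>F e in at_right 0. e * (R (fst p) - c) < L (snd p) - h (fst p)"
      by (intro order_tendstoD) auto
  qed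
  then have "\<forall>\<^sub>F e in at_right (0::real). e > 0 \<and> (\<forall>p \<in> {(x, y) \<in> V \<times> V. h x < L y}.
          e * (R (fst p) - c) < L (snd p) - h (fst p))"
    using eventually_at_right_less by (rule eventually_conj[rotated])
  then obtain e :: real where e: "e > 0"
    and small: "\<And>x y. x \<in> V \<Longrightarrow> y \<in> V \<Longrightarrow> h x < L y \<Longrightarrow> e * (R x - c) < L y - h x"
    using eventually_happens'[OF trivial_limit_at_right_real] by fastforce
  \<comment> \<open>The added term is strictly increasing in \<open>R x\<close>, so it breaks the
    ties of \<open>h\<close>; subtracting the minimum \<open>c\<close> makes it nonnegative on
    \<open>V\<close>.\<close>
  define f where "f x = h x + e * (R x - c)" for x
  have f_ge: "h x \<le> f x" if "x \<in> V" for x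
    unfolding f_def using e c_le[OF that] by simp
  have L_le: "L y \<le> h x" if "x \<in> V" "y \<in> V" "L y \<le> f x" for x y
    using small[of x y] that unfolding f_def by linarith
  have f_less: "f x < f y" if "x \<in> V" "y \<in> V" "R x < R y" for x y
  proof -
    have "e * (R x - c) < e * (R y - c)" using e that(3) by simp
    then show ?thesis using h_mono[of x y] that unfolding f_def by linarith
  qed
  have f_mono: "f x \<le> f y" if "x \<in> V" "y \<in> V" "R x \<le> R y" for x y
    using f_less[of x y] h_mono[of x y] that unfolding f_def by (cases "R x = R y") auto
  \<comment> \<open>Since \<open>h x\<close> exceeds \<open>R x\<close>, it is some
    \<open>L z\<close> with \<open>D x z\<close>; then \<open>shift_left\<close> passes from
    \<open>z\<close> back to \<open>y\<close>.\<close>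
  have D_right: "D x y" if "x \<in> V" "y \<in> V" "R x < L y" "L y \<le> f x" for x y
  proof -
    have "R x < L y" "L y \<le> h x" using L_le that by blast+
    then obtain z where "z \<in> V" "D x z" "L y \<le> L z"
      using h_cases[of x] by force
    then show ?thesis using shift_left that by blast
  qed
  show ?thesis
  proof
    show "R x \<le> f x" if "x \<in> V" for x
      using h_ge[of x] f_ge[OF that] by linarith
    show "f x \<le> f y \<longleftrightarrow> R x \<le> R y" if "x \<in> V" "y \<in> V" for x y
      using f_less[of y x] f_mono[of x y] that by force
    show "D x y \<longleftrightarrow> L x \<le> f y \<and> L y \<le> f x" if V: "x \<in> V" "y \<in> V" for x y
    proof
      assume "D x y"
      then show "L x \<le> f y \<and> L y \<le> f x"
        using h_ge_L[of y x] h_ge_L[of x y] f_ge[of x] f_ge[of y] sym[of x y] V by force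
    next
      assume "L x \<le> f y \<and> L y \<le> f x"
      then show "D x y"
        using D_right[of x y] D_right[of y x] sym[of y x] meet[of x y] V by force
    qed
  qed
qed

theorem theorem1:
  fixes G :: "'a pair_pre_digraph" and k :: nat and I :: "'a \<Rightarrow> real interval"
  assumes "pair_graph G"
    and "k \<ge> 2"
    and "interval_graph (graph_power G (k - 1))"
    and "interval_representation (graph_power G (k - 1)) I"
  shows "\<exists>I' :: 'a \<Rightarrow> real interval.
           interval_representation (graph_power G k) I' \<and>
           (\<forall>x \<in> pverts G. set_of (I x) \<subseteq> set_of (I' x)) \<and>
           left_endpoint_order (pverts G) I = left_endpoint_order (pverts G) I' \<and>
           right_endpoint_order (pverts G) I = right_endpoint_order (pverts G) I'"
proof -
  interpret pair_graph G by fact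
  define V where "V = pverts G"
  define L R where "L x = lower (I x)" and "R x = upper (I x)" for x
  define D where "D n x y \<longleftrightarrow> graph_dist G x y \<le> ereal (real n)" for n x y
  define m where "m = k - 1"
  \<comment> \<open>The two forms of \<open>k\<close> put the single arc at the end or at the start
    of a walk.\<close>
  have m: "m \<ge> 1" and k: "k = m + 1" "k = 1 + m" using assms(2) by (auto simp: m_def)
  have LR: "L x \<le> R x" for x by (simp add: L_def R_def)
  have D_add: "D (a + b) x y \<longleftrightarrow> (\<exists>z\<in>V. D a x z \<and> D b z y)" for a b x y
    unfolding D_def V_def by (rule graph_dist_le_add_iff)
  have D_sym: "D n y x" if "D n x y" for n x y
    using that unfolding D_def by (rule graph_dist_sym_le)
  have D_1: "D m x y" if "D 1 x y" for x y
    using that m unfolding D_def by (elim order_trans) simp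
  have D_m: "D m x y \<longleftrightarrow> L x \<le> R y \<and> L y \<le> R x" if "x \<in> V" "y \<in> V" for x y
  proof (cases "x = y")
    case True
    then show ?thesis using LR graph_dist_self_le that by (simp add: D_def V_def)
  next
    case False
    then show ?thesis
      using assms(4) that
      unfolding interval_representation_def intervals_meet_iff
      by (auto simp: graph_power_def D_def V_def L_def R_def m_def)
  qed
  obtain f where f_ge: "\<And>x. x \<in> V \<Longrightarrow> R x \<le> f x"
    and f_ord: "\<And>x y. x \<in> V \<Longrightarrow> y \<in> V \<Longrightarrow> f x \<le> f y \<longleftrightarrow> R x \<le> R y"
    and D_k: "\<And>x y. x \<in> V \<Longrightarrow> y \<in> V \<Longrightarrow> D k x y \<longleftrightarrow> L x \<le> f y \<and> L y \<le> f x"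
  proof (rule right_prolongation[of V "D k" L R])
    show "finite V" by (simp add: V_def pair_finite_verts)
    show "D k y x" if "D k x y" for x y using that by (rule D_sym)
    show "D k x y" if "x \<in> V" "y \<in> V" "L x \<le> R y" "L y \<le> R x" for x y
    proof -
      have "D m x y" using D_m that by blast
      then show ?thesis unfolding D_def by (rule order_trans) (simp add: k)
    qed
    show "D k x y'" if "x \<in> V" "y \<in> V" "y' \<in> V" "D k x y" "R x < L y'" "L y' \<le> L y" for x y y'
    proof -
      \<comment> \<open>As \<open>y\<close> is the end that moves, the single arc is taken at
        \<open>x\<close>. The interval of \<open>z\<close> covers the gap from \<open>R x\<close> to
        \<open>L y\<close>, hence contains \<open>L y'\<close>.\<close>
      from that(4) obtain z where z: "z \<in> V" "D 1 x z" "D m z y"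
        unfolding k(2) D_add by blast
      have "L z \<le> R x" "L y \<le> R z" using D_1[OF z(2)] z D_m that by auto
      then have "D m z y'" using D_m[of z y'] z that LR[of y'] by linarith
      then show ?thesis unfolding k(2) D_add using z by blast
    qed
    show "D k x' y" if "x \<in> V" "x' \<in> V" "y \<in> V" "D k x y" "R x \<le> R x'" "R x' < L y" for x x' y
    proof -
      \<comment> \<open>Mirror image: the single arc is now at \<open>y\<close>, and the interval of
        \<open>z\<close> contains \<open>R x'\<close>.\<close>
      from that(4) obtain z where z: "z \<in> V" "D m x z" "D 1 z y"
        unfolding k(1) D_add by blast
      have "L z \<le> R x" "L y \<le> R z" using D_1[OF z(3)] z D_m that by auto
      then have "D m x' z" using D_m[of x' z] z that LR[of x'] by linarith
      then show ?thesis unfolding k(1) D_add using z by blast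
    qed
  qed blast
  \<comment> \<open>Left endpoints stay fixed. Only on \<open>V\<close> is
    \<open>L x \<le> f x\<close> known, so the endpoints of \<open>I' x\<close> are computed only
    there.\<close>
  define I' where "I' x = Interval (L x, f x)" for x
  have I': "lower (I' x) = L x" "upper (I' x) = f x" if "x \<in> V" for x
    using LR[of x] f_ge[OF that] by (simp_all add: I'_def lower.abs_eq upper.abs_eq eq_onp_def)
  show ?thesis
  proof (intro exI[of _ I'] conjI)
    show "interval_representation (graph_power G k) I'"
      unfolding interval_representation_def intervals_meet_iff
      using D_k I' by (simp add: graph_power_def D_def V_def)
    show "\<forall>x\<in>pverts G. set_of (I x) \<subseteq> set_of (I' x)"
      using f_ge I' by (simp add: set_of_eq V_def L_def R_def)
    show "left_endpoint_order (pverts G) I = left_endpoint_order (pverts G) I'"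
      using I' by (auto simp: left_endpoint_order_def V_def L_def)
    show "right_endpoint_order (pverts G) I = right_endpoint_order (pverts G) I'"
      using I' f_ord by (auto simp: right_endpoint_order_def V_def R_def)
  qed
qed

end
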